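(* Let $\Phi:\mathbb{R}\to\mathbb{R}$ be a real-valued strictly positive definite function, and assume that $\Phi$ is of class $C^{2n}$ in some neighborhood of the origin for some positive integer $n\ge 2$. Then $\Phi\in C^{2n}(\mathbb{R})$. Also, for any (generalized) tempered stable Lévy measure $$\nu(j,\mathrm{d}z)=\left(\frac{C^j_+\,w(\beta^j_+ z)}{z^{1+\alpha^j_+}}\mathbb{1}_{z>0}+\frac{C^j_-\,w(\beta^j_-|z|)}{|z|^{1+\alpha^j_-}}\mathbb{1}_{z<0}\right)\mathrm{d}z$$ with $\alpha^j_\pm<2$, the integral $$I_v(x):=\int_{\mathbb{R}}\left(\Phi(x+z)-\Phi(x)-z\,\mathbb{1}_{|z|\le 1}\,\frac{\partial}{\partial x}\Phi(x)\right)\nu(j,\mathrm{d}z)$$ is finite for all $x\in\mathbb{R}$ and without singularity at the origin.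
   Context: Strict positive definiteness: a radially symmetric function $\Phi:\mathbb{R}^d\to\mathbb{R}$ (i.e. $\Phi(\mathbf{x})=\Phi(\mathbf{y})$ whenever $\|\mathbf{x}\|_2=\|\mathbf{y}\|_2$; for $d=1$ this means $\Phi$ is even) is positive definite if for every $k\in\mathbb{N}$, all pairwise different points $\mathbf{x}_1,\dots,\mathbf{x}_k\in\mathbb{R}^d$ and every $\mathbf{c}=(c_1,\dots,c_k)\in\mathbb{R}^k$ one has $\sum_{i=1}^k\sum_{l=1}^k c_ic_l\Phi(\mathbf{x}_i-\mathbf{x}_l)\ge 0$. It is strictly positive definite if, in addition, this quadratic form is zero only for $\mathbf{c}=\mathbf{0}$. Here $d=1$. The class $\mathbf{W}$: the set of continuous functions $w:(0,\infty)\to[0,\infty)$ that are decreasing, satisfy $w(0^+)=1$, and satisfy $\lim_{z\to\infty}z^m w(z)=0$ for all $m\in\mathbb{N}$. Generalized tempered stable Lévy measure: a measure on $\mathbb{R}$ of the displayed form, with $w\in\mathbf{W}$ and parameters $\alpha^j_\pm<2$, $C^j_\pm>0$, $\beta^j_\pm>0$ chosen such that $|z|^m C^j_\pm w(\beta^j_\pm|z|)$ is bounded on $\mathbb{R}$ for each $m\in\mathbb{N}$. As a Lévy measure it has no mass at $0$. The index $j\in\{1,\dots,H\}$ is a label (an economic regime) and is fixed throughout. $\mathbb{1}$ denotes an indicator function. *)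

theory Defs
  imports "HOL-Analysis.Analysis"
begin

definition radially_symmetric :: "('a::euclidean_space \<Rightarrow> real) \<Rightarrow> bool" where
  "radially_symmetric \<Phi> \<longleftrightarrow> (\<forall>x y. norm x = norm y \<longrightarrow> \<Phi> x = \<Phi> y)"

definition positive_definite :: "('a::euclidean_space \<Rightarrow> real) \<Rightarrow> bool" where
  "positive_definite \<Phi> \<longleftrightarrow> radially_symmetric \<Phi> \<and>
     (\<forall>(k::nat) (x::nat \<Rightarrow> 'a) (c::nat \<Rightarrow> real). inj_on x {1..k} \<longrightarrow>
        (\<Sum>i=1..k. \<Sum>l=1..k. c i * c l * \<Phi> (x i - x l)) \<ge> 0)"

definition strictly_positive_definite :: "('a::euclidean_space \<Rightarrow> real) \<Rightarrow> bool" where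
  "strictly_positive_definite \<Phi> \<longleftrightarrow> positive_definite \<Phi> \<and>
     (\<forall>(k::nat) (x::nat \<Rightarrow> 'a) (c::nat \<Rightarrow> real). inj_on x {1..k} \<longrightarrow>
        (\<Sum>i=1..k. \<Sum>l=1..k. c i * c l * \<Phi> (x i - x l)) = 0 \<longrightarrow> (\<forall>i\<in>{1..k}. c i = 0))"

text \<open>The class \<open>C\<^sup>k\<close> on an open set; openness is needed for the two-sided
  derivative \<^const>\<open>deriv\<close> to be determined by the values on the set.\<close>

fun Ck_on :: "nat \<Rightarrow> (real \<Rightarrow> real) \<Rightarrow> real set \<Rightarrow> bool" where
  "Ck_on 0 f S \<longleftrightarrow> continuous_on S f"
| "Ck_on (Suc k) f S \<longleftrightarrow> f differentiable_on S \<and> Ck_on k (deriv f) S"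

text \<open>Members of \<open>W\<close> are functions on \<open>(0,\<infinity>)\<close>, represented by total functions whose
  values outside \<open>(0,\<infinity>)\<close> are unconstrained. Decreasing is understood non-strictly.\<close>

definition class_W :: "(real \<Rightarrow> real) set" where
  "class_W = {w. continuous_on {0<..} w \<and> (\<forall>z>0. w z \<ge> 0) \<and> antimono_on {0<..} w \<and>
     (w \<longlongrightarrow> 1) (at_right 0) \<and> (\<forall>m::nat. ((\<lambda>z. z ^ m * w z) \<longlongrightarrow> 0) at_top)}"

text \<open>The indicators remove the values of \<open>w\<close> on \<open>(-\<infinity>,0]\<close>, so the density does not
  depend on them; in particular it vanishes at \<open>0\<close>.\<close>

definition gts_density ::
    "(real \<Rightarrow> real) \<Rightarrow> real \<Rightarrow> real \<Rightarrow> real \<Rightarrow> real \<Rightarrow> real \<Rightarrow> real \<Rightarrow> real \<Rightarrow> real" where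
  "gts_density w \<alpha>p \<alpha>m Cp Cm \<beta>p \<beta>m z =
     Cp * w (\<beta>p * z) / z powr (1 + \<alpha>p) * indicator {z. z > 0} z +
     Cm * w (\<beta>m * \<bar>z\<bar>) / \<bar>z\<bar> powr (1 + \<alpha>m) * indicator {z. z < 0} z"

text \<open>The measures \<open>\<nu>(j,dz)\<close> for a fixed label \<open>j\<close>. In the boundedness conditions the
  single point \<open>z = 0\<close>, where \<open>w\<close> takes an unconstrained value, plays no role.\<close>

definition gen_tempered_stable :: "real measure \<Rightarrow> bool" where
  "gen_tempered_stable \<nu> \<longleftrightarrow> (\<exists>w\<in>class_W. \<exists>\<alpha>p \<alpha>m Cp Cm \<beta>p \<beta>m.
     \<alpha>p < 2 \<and> \<alpha>m < 2 \<and> Cp > 0 \<and> Cm > 0 \<and> \<beta>p > 0 \<and> \<beta>m > 0 \<and>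
     (\<forall>m::nat. bounded (range (\<lambda>z::real. \<bar>z\<bar> ^ m * (Cp * w (\<beta>p * \<bar>z\<bar>))))) \<and>
     (\<forall>m::nat. bounded (range (\<lambda>z::real. \<bar>z\<bar> ^ m * (Cm * w (\<beta>m * \<bar>z\<bar>))))) \<and>
     \<nu> = density lborel (\<lambda>z. ennreal (gts_density w \<alpha>p \<alpha>m Cp Cm \<beta>p \<beta>m z)))"

definition jump_integrand :: "(real \<Rightarrow> real) \<Rightarrow> real \<Rightarrow> real \<Rightarrow> real" where
  "jump_integrand \<Phi> x z = \<Phi> (x + z) - \<Phi> x - z * indicator {z. \<bar>z\<bar> \<le> 1} z * deriv \<Phi> x"

text \<open>As a Bochner integral this has the junk value \<open>0\<close> if the integrand is not integrable, so
  finiteness has to be expressed by integrability of \<^const>\<open>jump_integrand\<close>.\<close>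

definition jump_integral :: "(real \<Rightarrow> real) \<Rightarrow> real measure \<Rightarrow> real \<Rightarrow> real" where
  "jump_integral \<Phi> \<nu> x = (LINT z|\<nu>. jump_integrand \<Phi> x z)"

end

theory Submission
  imports Defs
begin

text \<open>Finite combinations of point masses carry the semi-inner product induced by \<open>\<Phi>\<close>,
  and pairing with a point mass reproduces a translate of \<open>\<Phi>\<close>. This form is translation
  invariant, so whether difference quotients of point masses form a Cauchy family at \<open>x\<close> depends
  only on \<open>\<Phi>\<close> near the origin. By Cauchy--Schwarz, smoothness of order two at the origin
  therefore spreads to the whole line. As \<open>-\<Phi>''\<close> is a limit of second differences, it is again
  positive definite, and induction gives order \<open>2n\<close>. In particular \<open>\<Phi>\<close> and \<open>\<Phi>''\<close> are bounded by
  their values at \<open>0\<close>, so the jump integrand is at most a constant times \<open>min 1 (z\<^sup>2)\<close>, uniformly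
  in \<open>x\<close>; this is integrable for the Levy measure, and dominated convergence gives continuity.\<close>

subsection \<open>The semi-inner product of a positive definite function\<close>

text \<open>The list \<open>[(c\<^sub>1, a\<^sub>1), \<dots>]\<close> stands for the combination of point masses
  \<open>c\<^sub>1 \<delta>(a\<^sub>1) + \<dots>\<close>; points may repeat.\<close>

definition kernel_form ::
    "('a::euclidean_space \<Rightarrow> real) \<Rightarrow> (real \<times> 'a) list \<Rightarrow> (real \<times> 'a) list \<Rightarrow> real" where
  "kernel_form \<Phi> xs ys = (\<Sum>(c, a)\<leftarrow>xs. \<Sum>(d, b)\<leftarrow>ys. c * d * \<Phi> (a - b))"

text \<open>Positive definiteness speaks of pairwise different points, while lists may repeat them;
  coefficients at equal points are therefore collected first.\<close>

lemma sum_list_group_points: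
  fixes xs :: "(real \<times> 'a) list" and g :: "'a \<Rightarrow> real"
  assumes "finite S" "snd ` set xs \<subseteq> S"
  shows "(\<Sum>(c, a)\<leftarrow>xs. c * g a) = (\<Sum>a\<in>S. (\<Sum>(c, p)\<leftarrow>xs. if p = a then c else 0) * g a)"
  using assms(2)
proof (induction xs)
  case (Cons y ys)
  obtain c p where y: "y = (c, p)" by (cases y)
  have "(\<Sum>a\<in>S. (if p = a then c else 0) * g a) = (\<Sum>a\<in>S. if p = a then c * g a else 0)"
    by (rule sum.cong) auto
  also have "\<dots> = c * g p"
    using Cons.prems assms(1) y by simp
  finally show ?case
    using Cons y by (simp add: distrib_right sum.distrib)
qed simp

text \<open>After collecting coefficients twice, the form becomes a double sum over a finite set of
  points; an injective enumeration of this set from \<open>1\<close> brings it into the shape of the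
  definition.\<close>

lemma kernel_form_nonneg:
  assumes "positive_definite \<Phi>"
  shows "0 \<le> kernel_form \<Phi> xs xs"
proof -
  define S where "S = snd ` set xs"
  define C where "C = (\<lambda>a. \<Sum>(c, p)\<leftarrow>xs. if p = a then c else 0)"
  have fin: "finite S" by (simp add: S_def)
  have group: "(\<Sum>(c, a)\<leftarrow>xs. c * g a) = (\<Sum>a\<in>S. C a * g a)" for g
    using sum_list_group_points[OF fin] unfolding S_def C_def by auto
  have "kernel_form \<Phi> xs xs = (\<Sum>(c, a)\<leftarrow>xs. c * (\<Sum>(d, b)\<leftarrow>xs. d * \<Phi> (a - b)))"
    by (simp add: kernel_form_def sum_list_const_mult[symmetric] split_def mult.assoc)
  also have "\<dots> = (\<Sum>a\<in>S. C a * (\<Sum>b\<in>S. C b * \<Phi> (a - b)))"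
    by (simp only: group)
  also have "\<dots> = (\<Sum>a\<in>S. \<Sum>b\<in>S. C a * C b * \<Phi> (a - b))"
    by (simp add: sum_distrib_left mult.assoc)
  finally have eq: "kernel_form \<Phi> xs xs = (\<Sum>a\<in>S. \<Sum>b\<in>S. C a * C b * \<Phi> (a - b))" .
  obtain x where x: "bij_betw x {1..card S} S"
    using ex_bij_betw_nat_finite_1[OF fin] by blast
  have "kernel_form \<Phi> xs xs
      = (\<Sum>i=1..card S. \<Sum>l=1..card S. C (x i) * C (x l) * \<Phi> (x i - x l))"
    unfolding eq by (simp add: sum.reindex_bij_betw[OF x, symmetric])
  also have "\<dots> \<ge> 0"
    using assms bij_betw_imp_inj_on[OF x] unfolding positive_definite_def
    by (elim conjE allE[where x="card S"] allE[where x=x] allE[where x="\<lambda>i. C (x i)"]) auto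
  finally show ?thesis .
qed

lemma kernel_form_append:
  "kernel_form \<Phi> (xs @ ys) zs = kernel_form \<Phi> xs zs + kernel_form \<Phi> ys zs"
  "kernel_form \<Phi> zs (xs @ ys) = kernel_form \<Phi> zs xs + kernel_form \<Phi> zs ys"
  by (simp_all add: kernel_form_def split_def sum_list_addf)

lemma kernel_form_scale:
  "kernel_form \<Phi> (map (apfst ((*) s)) xs) zs = s * kernel_form \<Phi> xs zs"
  "kernel_form \<Phi> zs (map (apfst ((*) s)) xs) = s * kernel_form \<Phi> zs xs"
  by (simp_all add: kernel_form_def split_def sum_list_const_mult[symmetric] o_def mult_ac)

lemma positive_definite_minus:
  "positive_definite \<Phi> \<Longrightarrow> \<Phi> (- x) = \<Phi> x"
  unfolding positive_definite_def radially_symmetric_def using norm_minus_cancel by blast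

lemma kernel_form_commute:
  assumes "positive_definite \<Phi>"
  shows "kernel_form \<Phi> xs ys = kernel_form \<Phi> ys xs"
proof (induction xs)
  case Nil
  then show ?case by (simp add: kernel_form_def split_def)
next
  case (Cons x xs)
  have "\<Phi> (a - b) = \<Phi> (b - a)" for a b
    using positive_definite_minus[OF assms, of "a - b"] by simp
  then have "kernel_form \<Phi> [x] ys = kernel_form \<Phi> ys [x]"
    by (simp add: kernel_form_def split_def mult_ac)
  with Cons show ?case
    using kernel_form_append[of \<Phi> "[x]" xs ys] kernel_form_append(2)[of \<Phi> ys "[x]" xs] by simp
qed

lemma kernel_form_Cauchy_Schwarz:
  assumes "positive_definite \<Phi>"
  shows "(kernel_form \<Phi> xs ys)\<^sup>2 \<le> kernel_form \<Phi> xs xs * kernel_form \<Phi> ys ys"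
proof -
  define a where "a = kernel_form \<Phi> xs xs"
  define b where "b = kernel_form \<Phi> ys ys"
  define B where "B = kernel_form \<Phi> xs ys"
  have nonneg: "a \<ge> 0" "b \<ge> 0"
    unfolding a_def b_def by (simp_all add: kernel_form_nonneg assms)
  have q: "0 \<le> s * s * a + 2 * s * t * B + t * t * b" for s t
  proof -
    let ?zs = "map (apfst ((*) s)) xs @ map (apfst ((*) t)) ys"
    have "kernel_form \<Phi> ?zs ?zs = s * s * a + 2 * s * t * B + t * t * b"
      using kernel_form_commute[OF assms, of ys xs]
      by (simp add: kernel_form_append kernel_form_scale a_def b_def B_def algebra_simps)
    then show ?thesis using kernel_form_nonneg[OF assms, of ?zs] by simp
  qed
  have "B\<^sup>2 \<le> a * b"
  \<comment> \<open>The form is only semidefinite, so both squared norms may vanish; then the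
    weights \<open>1\<close> and \<open>- B\<close> turn \<open>q\<close> into
    \<open>0 \<le> - 2 * B\<^sup>2\<close>. Otherwise \<open>q\<close> gives the discriminant
    inequality multiplied by \<open>a\<close> and by \<open>b\<close>, and one of these factors is
    positive.\<close>
  proof (cases "a = 0 \<and> b = 0")
    case True
    then show ?thesis using q[of 1 "- B"] by (simp add: power2_eq_square)
  next
    case False
    have "0 \<le> b * (a * b - B\<^sup>2)" "0 \<le> a * (a * b - B\<^sup>2)"
      using q[of b "- B"] q[of "- B" a] by (simp_all add: algebra_simps power2_eq_square)
    then show ?thesis
      using False nonneg by (auto simp: zero_le_mult_iff)
  qed
  then show ?thesis by (simp add: a_def b_def B_def)
qed

text \<open>Cauchy--Schwarz in the shape in which it is applied: a small bound on one squared norm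
  and a fixed bound on the other.\<close>

lemma kernel_form_bound:
  assumes "positive_definite \<Phi>" "kernel_form \<Phi> xs xs \<le> K" "kernel_form \<Phi> ys ys \<le> L"
  shows "\<bar>kernel_form \<Phi> xs ys\<bar> \<le> sqrt (K * L)"
proof -
  have "kernel_form \<Phi> xs xs * kernel_form \<Phi> ys ys \<le> K * L"
    using assms kernel_form_nonneg[OF assms(1), of xs] kernel_form_nonneg[OF assms(1), of ys]
    by (intro mult_mono) auto
  with kernel_form_Cauchy_Schwarz[OF assms(1), of xs ys] show ?thesis
    by (intro real_le_rsqrt) auto
qed

text \<open>Cauchy--Schwarz for the point masses at \<open>x\<close> and \<open>0\<close>, both of
  squared norm \<open>\<Phi> 0\<close>.\<close>

lemma positive_definite_abs_le:
  assumes "positive_definite \<Phi>"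
  shows "\<bar>\<Phi> x\<bar> \<le> \<Phi> 0"
proof -
  have "\<Phi> 0 \<ge> 0"
    using kernel_form_nonneg[OF assms, of "[(1, 0)]"] by (simp add: kernel_form_def)
  then show ?thesis
    using kernel_form_bound[OF assms, of "[(1, x)]" "\<Phi> 0" "[(1, 0)]" "\<Phi> 0"]
    by (simp add: kernel_form_def)
qed

text \<open>Pairing the point mass at \<open>0\<close> with the difference of those at
  \<open>y\<close> and \<open>x\<close> gives the increment of \<Phi>, and the squared norm of that
  difference depends on \<open>y - x\<close> only. This is the base case of the induction on the
  order of smoothness.\<close>

lemma positive_definite_isCont:
  assumes pd: "positive_definite \<Phi>" and cont: "isCont \<Phi> 0"
  shows "isCont \<Phi> x"
proof -
  have bound: "\<bar>\<Phi> y - \<Phi> x\<bar> \<le> sqrt (\<Phi> 0 * (2 * (\<Phi> 0 - \<Phi> (y - x))))" for y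
    using kernel_form_bound[OF pd, of "[(1, 0)]" "\<Phi> 0" "[(1, y), (- 1, x)]" "2 * (\<Phi> 0 - \<Phi> (y - x))"]
      positive_definite_minus[OF pd] positive_definite_minus[OF pd, of "y - x"]
    by (simp add: kernel_form_def)
  have "((\<lambda>y. \<Phi> (y - x)) \<longlongrightarrow> \<Phi> 0) (at x)"
    using cont by (intro isCont_tendsto_compose[of 0 \<Phi>]) (auto intro!: tendsto_eq_intros)
  then have "((\<lambda>y. sqrt (\<Phi> 0 * (2 * (\<Phi> 0 - \<Phi> (y - x))))) \<longlongrightarrow> sqrt (\<Phi> 0 * (2 * (\<Phi> 0 - \<Phi> 0)))) (at x)"
    by (intro tendsto_intros)
  then have "((\<lambda>y. \<Phi> y - \<Phi> x) \<longlongrightarrow> 0) (at x)"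
    by (intro Lim_null_comparison[of "\<lambda>y. \<Phi> y - \<Phi> x"]) (use bound in auto)
  then show ?thesis
    by (simp add: isCont_def LIM_zero_iff)
qed

subsection \<open>Regularity from the origin to the line\<close>

lemma mvt_closed_segment:
  fixes f :: "real \<Rightarrow> real"
  assumes "\<And>t. t \<in> closed_segment a b \<Longrightarrow> (f has_real_derivative f' t) (at t)"
  obtains t where "t \<in> closed_segment a b" "f b - f a = (b - a) * f' t"
proof (cases a b rule: linorder_cases)
  case less
  then obtain t where "t > a" "t < b" "f b - f a = (b - a) * f' t"
    using MVT2[of a b f f'] assms by (auto simp: closed_segment_eq_real_ivl)
  then show ?thesis using that[of t] less
    by (auto simp: closed_segment_eq_real_ivl)
next
  case equal
  then show ?thesis using that by auto
next
  case greater
  then obtain t where "t > b" "t < a" "f a - f b = (a - b) * f' t"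
    using MVT2[of b a f f'] assms by (auto simp: closed_segment_eq_real_ivl)
  then show ?thesis using that[of t] greater
    by (auto simp: closed_segment_eq_real_ivl algebra_simps)
qed

text \<open>The mean value theorem is applied twice: to \<open>f (t - k) - f t\<close> between
  \<open>0\<close> and \<open>h\<close>, then to \<open>f'\<close> between \<open>s\<close> and
  \<open>s - k\<close>. The second increment is \<open>- k\<close>, whence the sign.\<close>

lemma second_difference_mvt:
  fixes f :: "real \<Rightarrow> real"
  assumes f': "\<And>x. \<bar>x\<bar> < r \<Longrightarrow> (f has_real_derivative f' x) (at x)"
    and f'': "\<And>x. \<bar>x\<bar> < r \<Longrightarrow> (f' has_real_derivative f'' x) (at x)"
    and r: "\<bar>h\<bar> + \<bar>k\<bar> < r"
  obtains t where "\<bar>t\<bar> \<le> \<bar>h\<bar> + \<bar>k\<bar>" "f (h - k) - f h - f (- k) + f 0 = - (h * k * f'' t)"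
proof -
  have seg: "\<bar>t\<bar> \<le> \<bar>h\<bar>" if "t \<in> closed_segment 0 h" for t
    using that by (auto simp: closed_segment_eq_real_ivl split: if_splits)
  have "((\<lambda>t. f (t - k) - f t) has_real_derivative f' (t - k) - f' t) (at t)"
    if "t \<in> closed_segment 0 h" for t
  proof -
    have "((\<lambda>t. f (t - k)) has_real_derivative f' (t - k)) (at t)"
      using f'[of "t - k"] seg[OF that] r DERIV_shift[of f "f' (t - k)" t "- k"] by simp
    then show ?thesis
      using f'[of t] seg[OF that] r by (auto intro!: derivative_intros)
  qed
  then obtain s where s: "s \<in> closed_segment 0 h"
      "(f (h - k) - f h) - (f (0 - k) - f 0) = (h - 0) * (f' (s - k) - f' s)"
    using mvt_closed_segment[of 0 h "\<lambda>t. f (t - k) - f t" "\<lambda>t. f' (t - k) - f' t"] by blast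
  have seg2: "\<bar>t\<bar> \<le> \<bar>h\<bar> + \<bar>k\<bar>" if "t \<in> closed_segment s (s - k)" for t
    using that seg[OF s(1)] by (auto simp: closed_segment_eq_real_ivl split: if_splits)
  have "(f' has_real_derivative f'' t) (at t)" if "t \<in> closed_segment s (s - k)" for t
    using f''[of t] seg2[OF that] r by simp
  then obtain t where t: "t \<in> closed_segment s (s - k)" "f' (s - k) - f' s = (s - k - s) * f'' t"
    using mvt_closed_segment[of s "s - k" f' f''] by blast
  show ?thesis
    using that[of t] seg2[OF t(1)] s(2) t(2) by simp
qed

text \<open>Completeness of the reals; it yields derivatives away from the origin, where no
  candidate for the limit is at hand.\<close>

lemma tendsto_at_0_Cauchy:
  fixes q :: "real \<Rightarrow> real"
  assumes "\<And>e. e > 0 \<Longrightarrow> \<exists>d>0. \<forall>h k. 0 < \<bar>h\<bar> \<and> \<bar>h\<bar> < d \<and> 0 < \<bar>k\<bar> \<and> \<bar>k\<bar> < d \<longrightarrow> \<bar>q h - q k\<bar> < e"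
  shows "\<exists>L. (q \<longlongrightarrow> L) (at 0)"
proof -
  have "cauchy_filter (filtermap q (at 0))"
    unfolding cauchy_filter_metric_filtermap
  proof (intro allI impI)
    fix e :: real assume "e > 0"
    then obtain d where d: "d > 0"
      "\<And>h k. 0 < \<bar>h\<bar> \<and> \<bar>h\<bar> < d \<and> 0 < \<bar>k\<bar> \<and> \<bar>k\<bar> < d \<Longrightarrow> \<bar>q h - q k\<bar> < e"
      using assms by metis
    have "eventually (\<lambda>h. 0 < \<bar>h\<bar> \<and> \<bar>h\<bar> < d) (at 0)"
      using d(1) by (auto simp: eventually_at dist_real_def)
    then show "\<exists>P. eventually P (at 0) \<and> (\<forall>x y. P x \<and> P y \<longrightarrow> dist (q x) (q y) < e)"
      using d(2) by (intro exI[of _ "\<lambda>h. 0 < \<bar>h\<bar> \<and> \<bar>h\<bar> < d"]) (auto simp: dist_real_def)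
  qed
  then show ?thesis
    using cauchy_filter_complete_converges[of "filtermap q (at 0)" UNIV]
    by (auto simp: filterlim_def complete_UNIV filtermap_bot_iff)
qed

text \<open>All regularity is assumed near the origin only; the results inside hold at every point
  of the line.\<close>

locale smooth_kernel =
  fixes \<Phi> \<Phi>' \<Phi>'' :: "real \<Rightarrow> real" and r :: real
  assumes pd: "positive_definite \<Phi>" and r_pos: "r > 0"
    and d1: "\<bar>x\<bar> < r \<Longrightarrow> (\<Phi> has_real_derivative \<Phi>' x) (at x)"
    and d2: "\<bar>x\<bar> < r \<Longrightarrow> (\<Phi>' has_real_derivative \<Phi>'' x) (at x)"
    and cont2: "isCont \<Phi>'' 0"
begin

text \<open>The difference quotient of point masses; paired with the point mass at \<open>b\<close>,
  it gives the difference quotient of \<Phi> at \<open>x - b\<close>.\<close>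

definition dq :: "real \<Rightarrow> real \<Rightarrow> (real \<times> real) list" where
  "dq x h = [(1 / h, x + h), (- (1 / h), x)]"

text \<open>This is \<open>dq x h\<close> minus \<open>dq x k\<close>, the quantity that a Cauchy
  argument has to make small.\<close>

definition dq_diff :: "real \<Rightarrow> real \<Rightarrow> real \<Rightarrow> (real \<times> real) list" where
  "dq_diff x h k = [(1 / h, x + h), (- (1 / h), x), (- (1 / k), x + k), (1 / k, x)]"

text \<open>For every base point, the quotient is the pairing of the difference quotients with steps
  \<open>h\<close> and \<open>k\<close>. By the mean value theorem it equals
  \<open>- \<Phi>'' t\<close> for some \<open>t\<close> near \<open>0\<close>.\<close>

lemma mixed_quotient_near:
  assumes "e > 0"
  shows "\<exists>d>0. \<forall>h k. 0 < \<bar>h\<bar> \<and> \<bar>h\<bar> < d \<and> 0 < \<bar>k\<bar> \<and> \<bar>k\<bar> < d \<longrightarrow>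
    \<bar>(\<Phi> (h - k) - \<Phi> h - \<Phi> (- k) + \<Phi> 0) / (h * k) + \<Phi>'' 0\<bar> < e"
proof -
  obtain d where d: "d > 0" "\<And>t. \<bar>t\<bar> < d \<Longrightarrow> \<bar>\<Phi>'' t - \<Phi>'' 0\<bar> < e"
    using cont2 assms unfolding continuous_at_eps_delta dist_real_def by force
  show ?thesis
  \<comment> \<open>Halving keeps \<open>\<bar>h\<bar> + \<bar>k\<bar>\<close> below both
    \<open>r\<close> and \<open>d\<close>.\<close>
  proof (intro exI[of _ "min d r / 2"] conjI allI impI)
    show "0 < min d r / 2" using d r_pos by simp
    fix h k :: real
    assume hk: "0 < \<bar>h\<bar> \<and> \<bar>h\<bar> < min d r / 2 \<and> 0 < \<bar>k\<bar> \<and> \<bar>k\<bar> < min d r / 2"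
    then obtain t where t: "\<bar>t\<bar> \<le> \<bar>h\<bar> + \<bar>k\<bar>"
        "\<Phi> (h - k) - \<Phi> h - \<Phi> (- k) + \<Phi> 0 = - (h * k * \<Phi>'' t)"
      using second_difference_mvt[of r \<Phi> \<Phi>' \<Phi>'' h k] d1 d2 by (auto simp: min_def split: if_splits)
    have "\<bar>\<Phi>'' t - \<Phi>'' 0\<bar> < e"
      using t(1) hk by (intro d(2)) (auto simp: min_def split: if_splits)
    then show "\<bar>(\<Phi> (h - k) - \<Phi> h - \<Phi> (- k) + \<Phi> 0) / (h * k) + \<Phi>'' 0\<bar> < e"
      unfolding t(2) using hk by simp
  qed
qed

text \<open>The squared norm is a combination of four mixed quotients with signs \<open>+\<close>,
  \<open>-\<close>, \<open>-\<close>, \<open>+\<close>. Each is within \<open>e / 4\<close> of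
  \<open>- \<Phi>'' 0\<close>, so the limits cancel. By translation invariance, \<open>d\<close>
  serves all \<open>x\<close> at once.\<close>

lemma kernel_form_dq_diff_small:
  assumes "e > 0"
  shows "\<exists>d>0. \<forall>x h k. 0 < \<bar>h\<bar> \<and> \<bar>h\<bar> < d \<and> 0 < \<bar>k\<bar> \<and> \<bar>k\<bar> < d \<longrightarrow>
    kernel_form \<Phi> (dq_diff x h k) (dq_diff x h k) \<le> e"
proof -
  define G where "G = (\<lambda>h k. (\<Phi> (h - k) - \<Phi> h - \<Phi> (- k) + \<Phi> 0) / (h * k))"
  have "e / 4 > 0" using assms by simp
  from mixed_quotient_near[OF this] obtain d where d: "d > 0"
    "\<And>h k. 0 < \<bar>h\<bar> \<and> \<bar>h\<bar> < d \<and> 0 < \<bar>k\<bar> \<and> \<bar>k\<bar> < d \<Longrightarrow> \<bar>G h k + \<Phi>'' 0\<bar> < e / 4"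
    unfolding G_def by blast
  have "kernel_form \<Phi> (dq_diff x h k) (dq_diff x h k) \<le> e"
    if hk: "0 < \<bar>h\<bar> \<and> \<bar>h\<bar> < d \<and> 0 < \<bar>k\<bar> \<and> \<bar>k\<bar> < d" for x h k
  proof -
    have "kernel_form \<Phi> (dq_diff x h k) (dq_diff x h k) = G h h - G h k - G k h + G k k"
      using hk by (simp add: kernel_form_def dq_diff_def G_def field_simps)
    then show ?thesis
      using d(2)[of h k] d(2)[of k h] d(2)[of h h] d(2)[of k k] hk by linarith
  qed
  with d(1) show ?thesis by blast
qed

text \<open>The diagonal case of the mixed quotient, which tends to \<open>- \<Phi>'' 0\<close>; the
  summand \<open>1\<close> is slack.\<close>

lemma kernel_form_dq_bounded:
  "\<exists>d>0. \<forall>x h. 0 < \<bar>h\<bar> \<and> \<bar>h\<bar> < d \<longrightarrow> kernel_form \<Phi> (dq x h) (dq x h) \<le> 1 - \<Phi>'' 0"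
proof -
  obtain d where d: "d > 0" "\<And>h. 0 < \<bar>h\<bar> \<and> \<bar>h\<bar> < d \<Longrightarrow>
      \<bar>(\<Phi> (h - h) - \<Phi> h - \<Phi> (- h) + \<Phi> 0) / (h * h) + \<Phi>'' 0\<bar> < 1"
    using mixed_quotient_near[of 1] zero_less_one by blast
  have "kernel_form \<Phi> (dq x h) (dq x h) \<le> 1 - \<Phi>'' 0" if h: "0 < \<bar>h\<bar> \<and> \<bar>h\<bar> < d" for x h
  proof -
    have "kernel_form \<Phi> (dq x h) (dq x h) = (\<Phi> (h - h) - \<Phi> h - \<Phi> (- h) + \<Phi> 0) / (h * h)"
      using h by (simp add: kernel_form_def dq_def field_simps)
    then show ?thesis using d(2)[OF h] by linarith
  qed
  with d(1) show ?thesis by blast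
qed

text \<open>Pairing \<open>dq_diff x h k\<close> with the point mass at \<open>0\<close> gives the
  difference of two difference quotients of \<Phi> at \<open>x\<close>; Cauchy--Schwarz makes it
  small.\<close>

lemma ex_deriv:
  "\<exists>D. (\<Phi> has_real_derivative D) (at x)"
proof -
  have "\<exists>L. ((\<lambda>h. (\<Phi> (x + h) - \<Phi> x) / h) \<longlongrightarrow> L) (at 0)"
  proof (rule tendsto_at_0_Cauchy)
    fix e :: real assume "e > 0"
    \<comment> \<open>Chosen so that the Cauchy--Schwarz bound becomes \<open>e / 2\<close>; the
      added \<open>1\<close> makes the denominator positive from
      \<open>\<Phi> 0 \<ge> 0\<close>.\<close>
    define E where "E = (e / 2)\<^sup>2 / (\<Phi> 0 + 1)"
    have \<Phi>0: "\<Phi> 0 \<ge> 0" using positive_definite_abs_le[OF pd, of 0] by simp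
    then have "E > 0" using \<open>e > 0\<close> by (simp add: E_def)
    from kernel_form_dq_diff_small[OF this] obtain d where d: "d > 0"
      "\<And>x h k. 0 < \<bar>h\<bar> \<and> \<bar>h\<bar> < d \<and> 0 < \<bar>k\<bar> \<and> \<bar>k\<bar> < d \<Longrightarrow>
        kernel_form \<Phi> (dq_diff x h k) (dq_diff x h k) \<le> E"
      by blast
    have "\<bar>(\<Phi> (x + h) - \<Phi> x) / h - (\<Phi> (x + k) - \<Phi> x) / k\<bar> < e"
      if hk: "0 < \<bar>h\<bar> \<and> \<bar>h\<bar> < d \<and> 0 < \<bar>k\<bar> \<and> \<bar>k\<bar> < d" for h k
    proof -
      have "kernel_form \<Phi> (dq_diff x h k) [(1, 0)] = (\<Phi> (x + h) - \<Phi> x) / h - (\<Phi> (x + k) - \<Phi> x) / k"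
        by (simp add: kernel_form_def dq_diff_def diff_divide_distrib)
      moreover have "\<bar>kernel_form \<Phi> (dq_diff x h k) [(1, 0)]\<bar> \<le> sqrt (E * (\<Phi> 0 + 1))"
        by (rule kernel_form_bound[OF pd d(2)[OF hk]]) (simp add: kernel_form_def)
      moreover have "sqrt (E * (\<Phi> 0 + 1)) = e / 2"
        using \<Phi>0 \<open>e > 0\<close> by (simp add: E_def real_sqrt_divide)
      ultimately show ?thesis using \<open>e > 0\<close> by linarith
    qed
    with d(1) show "\<exists>d>0. \<forall>h k. 0 < \<bar>h\<bar> \<and> \<bar>h\<bar> < d \<and> 0 < \<bar>k\<bar> \<and> \<bar>k\<bar> < d \<longrightarrow>
        \<bar>(\<Phi> (x + h) - \<Phi> x) / h - (\<Phi> (x + k) - \<Phi> x) / k\<bar> < e"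
      by blast
  qed
  then show ?thesis by (simp add: DERIV_def)
qed

lemma DERIV_kernel: "(\<Phi> has_real_derivative deriv \<Phi> x) (at x)"
  using ex_deriv DERIV_imp_deriv by blast

text \<open>Now \<open>dq_diff x h k\<close> is paired with a difference quotient at
  \<open>0\<close> of step size \<open>\<bar>s\<bar>\<close>, whose norm is bounded uniformly in
  \<open>s\<close>. As \<open>s\<close> tends to \<open>0\<close>, the bound passes to the quotients
  of \<open>deriv \<Phi>\<close>.\<close>

lemma ex_deriv2:
  "\<exists>D. (deriv \<Phi> has_real_derivative D) (at x)"
proof -
  let ?q = "\<lambda>y h. (\<Phi> (y + h) - \<Phi> y) / h"
  have q: "(?q y \<longlongrightarrow> deriv \<Phi> y) (at 0)" for y
    using DERIV_kernel by (simp add: DERIV_def)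
  obtain d0 where d0: "d0 > 0"
    "\<And>x h. 0 < \<bar>h\<bar> \<and> \<bar>h\<bar> < d0 \<Longrightarrow> kernel_form \<Phi> (dq x h) (dq x h) \<le> 1 - \<Phi>'' 0"
    using kernel_form_dq_bounded by blast
  have "0 < \<bar>d0 / 2\<bar> \<and> \<bar>d0 / 2\<bar> < d0" using d0(1) by simp
  then have M: "1 - \<Phi>'' 0 \<ge> 0"
    using d0(2)[of "d0 / 2" 0] kernel_form_nonneg[OF pd, of "dq 0 (d0 / 2)"] by linarith
  have "\<exists>L. ((\<lambda>h. (deriv \<Phi> (x + h) - deriv \<Phi> x) / h) \<longlongrightarrow> L) (at 0)"
  proof (rule tendsto_at_0_Cauchy)
    fix e :: real assume "e > 0"
    \<comment> \<open>The denominator is the norm bound \<open>1 - \<Phi>'' 0\<close> plus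
      \<open>1\<close>, hence positive.\<close>
    define E where "E = (e / 2)\<^sup>2 / (2 - \<Phi>'' 0)"
    have "E > 0" using \<open>e > 0\<close> M by (simp add: E_def)
    from kernel_form_dq_diff_small[OF this] obtain d where d: "d > 0"
      "\<And>x h k. 0 < \<bar>h\<bar> \<and> \<bar>h\<bar> < d \<and> 0 < \<bar>k\<bar> \<and> \<bar>k\<bar> < d \<Longrightarrow>
        kernel_form \<Phi> (dq_diff x h k) (dq_diff x h k) \<le> E"
      by blast
    have "\<bar>(deriv \<Phi> (x + h) - deriv \<Phi> x) / h - (deriv \<Phi> (x + k) - deriv \<Phi> x) / k\<bar> < e"
      if hk: "0 < \<bar>h\<bar> \<and> \<bar>h\<bar> < d \<and> 0 < \<bar>k\<bar> \<and> \<bar>k\<bar> < d" for h k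
    proof -
      let ?F = "\<lambda>s. (?q (x + h) s - ?q x s) / h - (?q (x + k) s - ?q x s) / k"
      have lim: "(?F \<longlongrightarrow> (deriv \<Phi> (x + h) - deriv \<Phi> x) / h - (deriv \<Phi> (x + k) - deriv \<Phi> x) / k) (at 0)"
        using hk by (intro tendsto_intros q) auto
      have "\<bar>?F s\<bar> \<le> e / 2" if s: "0 < \<bar>s\<bar> \<and> \<bar>s\<bar> < d0" for s
      proof -
        \<comment> \<open>The second argument enters \<Phi> with a minus sign, so the step
          \<open>- s\<close> produces the values \<open>\<Phi> (y + s)\<close>.\<close>
        have "kernel_form \<Phi> (dq_diff x h k) (dq 0 (- s)) = - ?F s"
          using s hk by (simp add: kernel_form_def dq_diff_def dq_def field_simps)
        moreover have "\<bar>kernel_form \<Phi> (dq_diff x h k) (dq 0 (- s))\<bar> \<le> sqrt (E * (2 - \<Phi>'' 0))"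
          using d0(2)[of "- s" 0] s by (intro kernel_form_bound[OF pd d(2)[OF hk]]) simp
        moreover have "sqrt (E * (2 - \<Phi>'' 0)) = e / 2"
          using M \<open>e > 0\<close> by (simp add: E_def real_sqrt_divide)
        ultimately show ?thesis by (simp only: abs_minus_cancel)
      qed
      then have "eventually (\<lambda>s. \<bar>?F s\<bar> \<le> e / 2) (at 0)"
        using d0(1) by (auto simp: eventually_at dist_real_def)
      then have "\<bar>(deriv \<Phi> (x + h) - deriv \<Phi> x) / h - (deriv \<Phi> (x + k) - deriv \<Phi> x) / k\<bar> \<le> e / 2"
        by (intro tendsto_upperbound[OF tendsto_rabs[OF lim]]) auto
      then show ?thesis using \<open>e > 0\<close> by linarith
    qed
    with d(1) show "\<exists>d>0. \<forall>h k. 0 < \<bar>h\<bar> \<and> \<bar>h\<bar> < d \<and> 0 < \<bar>k\<bar> \<and> \<bar>k\<bar> < d \<longrightarrow>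
        \<bar>(deriv \<Phi> (x + h) - deriv \<Phi> x) / h - (deriv \<Phi> (x + k) - deriv \<Phi> x) / k\<bar> < e"
      by blast
  qed
  then show ?thesis by (simp add: DERIV_def)
qed

lemma DERIV_deriv_kernel: "(deriv \<Phi> has_real_derivative deriv (deriv \<Phi>) x) (at x)"
  using ex_deriv2 DERIV_imp_deriv by blast

section \<open>Positive definiteness of the negative second derivative\<close>

lemma second_difference_tendsto:
  "((\<lambda>h. (2 * \<Phi> x - \<Phi> (x + h) - \<Phi> (x - h)) / h\<^sup>2) \<longlongrightarrow> - deriv (deriv \<Phi>) x) (at_right 0)"
proof (rule lhopital_right_0[where f' = "\<lambda>h. deriv \<Phi> (x - h) - deriv \<Phi> (x + h)" and g' = "\<lambda>h. 2 * h"])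
  have cont: "isCont \<Phi> y" for y using DERIV_kernel DERIV_isCont by blast
  have "((\<lambda>h. 2 * \<Phi> x - \<Phi> (x + h) - \<Phi> (x - h)) \<longlongrightarrow> 2 * \<Phi> x - \<Phi> (x + 0) - \<Phi> (x - 0)) (at_right 0)"
    by (intro tendsto_intros isCont_tendsto_compose[OF cont])
  then show "((\<lambda>h. 2 * \<Phi> x - \<Phi> (x + h) - \<Phi> (x - h)) \<longlongrightarrow> 0) (at_right 0)" by simp
  have "((\<lambda>h::real. h\<^sup>2) \<longlongrightarrow> 0\<^sup>2) (at_right 0)" by (intro tendsto_intros)
  then show "((\<lambda>h::real. h\<^sup>2) \<longlongrightarrow> 0) (at_right 0)" by simp
  show "\<forall>\<^sub>F h in at_right 0. h\<^sup>2 \<noteq> (0::real)" "\<forall>\<^sub>F h in at_right 0. 2 * h \<noteq> (0::real)"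
    by (auto simp: eventually_at_filter)
  show "\<forall>\<^sub>F h in at_right 0. ((\<lambda>h. h\<^sup>2) has_real_derivative 2 * h) (at h)"
    by (auto intro!: derivative_eq_intros always_eventually)
  have p: "((\<lambda>h. \<Phi> (x + h)) has_real_derivative deriv \<Phi> (x + h)) (at h)" for h
    using DERIV_shift[of \<Phi> "deriv \<Phi> (x + h)" h x] DERIV_kernel[of "x + h"] by (simp add: add.commute)
  have "((\<lambda>h. \<Phi> (x - h)) has_real_derivative deriv \<Phi> (x - h) * (0 - 1)) (at h)" for h
    by (rule DERIV_chain2[OF DERIV_kernel]) (intro derivative_intros)
  with p show "\<forall>\<^sub>F h in at_right 0. ((\<lambda>h. 2 * \<Phi> x - \<Phi> (x + h) - \<Phi> (x - h))
      has_real_derivative deriv \<Phi> (x - h) - deriv \<Phi> (x + h)) (at h)"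
    by (auto intro!: derivative_eq_intros always_eventually)
  let ?q = "\<lambda>h. (deriv \<Phi> (x + h) - deriv \<Phi> x) / h"
  have r: "(?q \<longlongrightarrow> deriv (deriv \<Phi>) x) (at 0)"
    using DERIV_deriv_kernel by (simp add: DERIV_def)
  \<comment> \<open>The quotient left by L'Hopital's rule is minus the average of the difference
    quotients of \<open>deriv \<Phi>\<close> with steps \<open>h\<close> and \<open>- h\<close>, so
    differentiability of \<open>deriv \<Phi>\<close> at \<open>x\<close> gives its limit.\<close>
  have "((\<lambda>h. - (?q h + ?q (- h)) / 2)
      \<longlongrightarrow> - (deriv (deriv \<Phi>) x + deriv (deriv \<Phi>) x) / 2) (at_right 0)"
  proof (intro tendsto_intros)
    show "(?q \<longlongrightarrow> deriv (deriv \<Phi>) x) (at_right 0)"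
      using r by (simp add: filterlim_at_split)
    have "filterlim uminus (at (0::real)) (at_right 0)"
      by (auto simp: filterlim_at eventually_at_filter intro!: tendsto_eq_intros)
    from filterlim_compose[OF r this]
    show "((\<lambda>h. ?q (- h)) \<longlongrightarrow> deriv (deriv \<Phi>) x) (at_right 0)" .
  qed simp
  moreover have "\<forall>\<^sub>F h in at_right 0. - (?q h + ?q (- h)) / 2 = (deriv \<Phi> (x - h) - deriv \<Phi> (x + h)) / (2 * h)"
    by (auto simp: eventually_at_filter field_simps)
  ultimately show "((\<lambda>h. (deriv \<Phi> (x - h) - deriv \<Phi> (x + h)) / (2 * h)) \<longlongrightarrow> - deriv (deriv \<Phi>) x) (at_right 0)"
    using Lim_transform_eventually by force
qed

text \<open>For each \<open>h > 0\<close> the form of the second difference quotient is a squared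
  norm divided by \<open>h\<^sup>2\<close>, and nonnegativity survives the limit.\<close>

lemma positive_definite_minus_deriv2:
  "positive_definite (\<lambda>x. - deriv (deriv \<Phi>) x)"
  unfolding positive_definite_def radially_symmetric_def
proof (intro conjI allI impI)
  fix x y :: real assume "norm x = norm y"
  then consider "x = y" | "x = - y" by fastforce
  then show "- deriv (deriv \<Phi>) x = - deriv (deriv \<Phi>) y"
  proof cases
    case 2
    \<comment> \<open>The second difference quotients at \<open>- y\<close> and \<open>y\<close>
      coincide, hence so do their limits.\<close>
    have "\<Phi> (- y + h) = \<Phi> (y - h)" "\<Phi> (- y - h) = \<Phi> (y + h)" for h
      using positive_definite_minus[OF pd, of "y - h"] positive_definite_minus[OF pd, of "y + h"]
      by simp_all
    then show ?thesis
      using second_difference_tendsto[of x] second_difference_tendsto[of y]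
      unfolding 2 positive_definite_minus[OF pd]
      by (intro tendsto_unique[OF trivial_limit_at_right_real]) (simp_all add: algebra_simps)
  qed simp
next
  fix k :: nat and x c :: "nat \<Rightarrow> real"
  let ?D = "\<lambda>h y. (2 * \<Phi> y - \<Phi> (y + h) - \<Phi> (y - h)) / h\<^sup>2"
  have "0 \<le> (\<Sum>i=1..k. \<Sum>l=1..k. c i * c l * ?D h (x i - x l))" if "h > 0" for h
  proof -
    \<comment> \<open>The combination with weights \<open>c i\<close> of the increments from
      \<open>x i\<close> to \<open>x i + h\<close>; pairing two increments gives exactly a second
      difference of \<Phi>.\<close>
    define xs where "xs = concat (map (\<lambda>i. [(c i, x i + h), (- c i, x i)]) [1..<Suc k])"
    have sum_xs: "(\<Sum>p\<leftarrow>xs. f p) = (\<Sum>i=1..k. f (c i, x i + h) + f (- c i, x i))"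
      for f :: "real \<times> real \<Rightarrow> real"
      unfolding xs_def by (induction k) (simp_all add: add.assoc)
    have "kernel_form \<Phi> xs xs = (\<Sum>i=1..k. \<Sum>l=1..k. c i * c l *
        (2 * \<Phi> (x i - x l) - \<Phi> (x i - x l + h) - \<Phi> (x i - x l - h)))"
      unfolding kernel_form_def sum_xs prod.case sum.distrib[symmetric]
      by (intro sum.cong refl) (simp add: algebra_simps)
    also have "\<dots> = h\<^sup>2 * (\<Sum>i=1..k. \<Sum>l=1..k. c i * c l * ?D h (x i - x l))"
      using that unfolding sum_distrib_left by (intro sum.cong refl) simp
    finally show ?thesis
      using kernel_form_nonneg[OF pd, of xs] that by (simp add: zero_le_mult_iff)
  qed
  then have "\<forall>\<^sub>F h in at_right 0. 0 \<le> (\<Sum>i=1..k. \<Sum>l=1..k. c i * c l * ?D h (x i - x l))"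
    by (auto simp: eventually_at_filter)
  moreover have "((\<lambda>h. \<Sum>i=1..k. \<Sum>l=1..k. c i * c l * ?D h (x i - x l)) \<longlongrightarrow>
      (\<Sum>i=1..k. \<Sum>l=1..k. c i * c l * - deriv (deriv \<Phi>) (x i - x l))) (at_right 0)"
    by (intro tendsto_intros second_difference_tendsto)
  ultimately show "0 \<le> (\<Sum>i=1..k. \<Sum>l=1..k. c i * c l * - deriv (deriv \<Phi>) (x i - x l))"
    by (intro tendsto_lowerbound[of _ _ "at_right (0::real)"]) auto
qed

subsection \<open>The jump integrand\<close>

text \<open>Two mean value steps replace Taylor's formula, at the cost of its factor 1/2. The second
  derivative is bounded by its modulus at \<open>0\<close> because its negative is positive
  definite.\<close>

lemma taylor_bound:
  "\<bar>\<Phi> (x + z) - \<Phi> x - z * deriv \<Phi> x\<bar> \<le> - deriv (deriv \<Phi>) 0 * z\<^sup>2"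
proof -
  define M where "M = - deriv (deriv \<Phi>) 0"
  have M: "\<bar>deriv (deriv \<Phi>) t\<bar> \<le> M" for t
    using positive_definite_abs_le[OF positive_definite_minus_deriv2, of t] by (simp add: M_def)
  obtain t where t: "t \<in> closed_segment x (x + z)" "\<Phi> (x + z) - \<Phi> x = (x + z - x) * deriv \<Phi> t"
    by (rule mvt_closed_segment[OF DERIV_kernel])
  obtain s where s: "s \<in> closed_segment x t" "deriv \<Phi> t - deriv \<Phi> x = (t - x) * deriv (deriv \<Phi>) s"
    by (rule mvt_closed_segment[OF DERIV_deriv_kernel])
  have "\<bar>t - x\<bar> \<le> \<bar>z\<bar>"
    using t(1) by (auto simp: closed_segment_eq_real_ivl split: if_splits)
  then have "\<bar>z\<bar> * (\<bar>t - x\<bar> * \<bar>deriv (deriv \<Phi>) s\<bar>) \<le> \<bar>z\<bar> * (\<bar>z\<bar> * M)"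
    using M[of s] by (intro mult_left_mono mult_mono) auto
  moreover have "\<Phi> (x + z) - \<Phi> x - z * deriv \<Phi> x = z * ((t - x) * deriv (deriv \<Phi>) s)"
    unfolding s(2)[symmetric] t(2) by (simp add: algebra_simps)
  ultimately show ?thesis
    by (simp add: abs_mult M_def power2_eq_square mult_ac)
qed

text \<open>Small jumps obey the Taylor bound; for large ones the compensator vanishes and
  \<open>2 * \<Phi> 0\<close> suffices. The constant adds both and is independent of
  \<open>x\<close>, as dominated convergence requires.\<close>

lemma jump_integrand_bound:
  "\<bar>jump_integrand \<Phi> x z\<bar> \<le> (2 * \<Phi> 0 - deriv (deriv \<Phi>) 0) * min 1 (z\<^sup>2)"
proof -
  have M: "- deriv (deriv \<Phi>) 0 \<ge> 0"
    using positive_definite_abs_le[OF positive_definite_minus_deriv2, of 0] by simp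
  have \<Phi>: "\<bar>\<Phi> y\<bar> \<le> \<Phi> 0" for y
    using positive_definite_abs_le[OF pd] .
  show ?thesis
  proof (cases "\<bar>z\<bar> \<le> 1")
    case True
    then have "min 1 (z\<^sup>2) = z\<^sup>2" by (simp add: abs_square_le_1 min_absorb2)
    moreover have "0 \<le> \<Phi> 0 * z\<^sup>2" using \<Phi>[of 0] by simp
    ultimately show ?thesis
      using taylor_bound[of x z] True by (simp add: jump_integrand_def algebra_simps)
  next
    case False
    then have "min 1 (z\<^sup>2) = 1" using abs_square_le_1[of z] by (simp add: min_def)
    then show ?thesis
      using False M \<Phi>[of "x + z"] \<Phi>[of x] by (simp add: jump_integrand_def)
  qed
qed

lemma isCont_jump_integrand: "isCont (\<lambda>x. jump_integrand \<Phi> x z) x"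
proof -
  have cont: "isCont \<Phi> y" "isCont (deriv \<Phi>) y" for y
    using DERIV_kernel DERIV_deriv_kernel DERIV_isCont by blast+
  have "isCont (\<lambda>x. \<Phi> (x + z)) x"
    by (rule isCont_o2[OF _ cont(1)]) simp
  then show ?thesis
    unfolding jump_integrand_def using cont by (intro continuous_intros)
qed

lemma borel_measurable_jump_integrand [measurable]: "jump_integrand \<Phi> x \<in> borel_measurable borel"
proof -
  have "continuous_on UNIV \<Phi>"
    using DERIV_kernel DERIV_isCont by (blast intro: continuous_at_imp_continuous_on)
  then have [measurable]: "\<Phi> \<in> borel_measurable borel"
    by (rule borel_measurable_continuous_onI)
  show ?thesis
    unfolding jump_integrand_def by measurable
qed

lemma integrable_jump_integrand:
  assumes sets: "sets \<nu> = sets borel" and int: "integrable \<nu> (\<lambda>z. min 1 (z\<^sup>2))"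
  shows "integrable \<nu> (jump_integrand \<Phi> x)"
proof (rule Bochner_Integration.integrable_bound)
  show "integrable \<nu> (\<lambda>z. (2 * \<Phi> 0 - deriv (deriv \<Phi>) 0) * min 1 (z\<^sup>2))"
    using int by simp
  show "jump_integrand \<Phi> x \<in> borel_measurable \<nu>"
    using borel_measurable_jump_integrand measurable_cong_sets[OF sets refl] by blast
  show "AE z in \<nu>. norm (jump_integrand \<Phi> x z) \<le> norm ((2 * \<Phi> 0 - deriv (deriv \<Phi>) 0) * min 1 (z\<^sup>2))"
    using jump_integrand_bound[of x] by (intro always_eventually) (force intro: order_trans[OF _ abs_ge_self])
qed

lemma isCont_jump_integral:
  assumes sets: "sets \<nu> = sets borel" and int: "integrable \<nu> (\<lambda>z. min 1 (z\<^sup>2))"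
  shows "isCont (jump_integral \<Phi> \<nu>) x"
proof (rule continuous_at_sequentiallyI)
  fix u :: "nat \<Rightarrow> real" assume u: "u \<longlonglongrightarrow> x"
  show "(\<lambda>i. jump_integral \<Phi> \<nu> (u i)) \<longlonglongrightarrow> jump_integral \<Phi> \<nu> x"
    unfolding jump_integral_def
  proof (rule integral_dominated_convergence)
    show "integrable \<nu> (\<lambda>z. (2 * \<Phi> 0 - deriv (deriv \<Phi>) 0) * min 1 (z\<^sup>2))"
      using int by simp
    show "AE z in \<nu>. (\<lambda>i. jump_integrand \<Phi> (u i) z) \<longlonglongrightarrow> jump_integrand \<Phi> x z"
      using isCont_tendsto_compose[OF isCont_jump_integrand u] by simp
    show "AE z in \<nu>. norm (jump_integrand \<Phi> (u i) z) \<le> (2 * \<Phi> 0 - deriv (deriv \<Phi>) 0) * min 1 (z\<^sup>2)" for i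
      using jump_integrand_bound by simp
  qed (use integrable_jump_integrand[OF assms] in \<open>auto dest: borel_measurable_integrable\<close>)
qed

end

subsection \<open>Functions of class \<open>C\<^sup>k\<close>\<close>

text \<open>Agreement on an open set is agreement near each of its points, so it passes to
  derivatives.\<close>

lemma Ck_on_cong:
  assumes "open S" "Ck_on k f S" "\<And>x. x \<in> S \<Longrightarrow> f x = g x"
  shows "Ck_on k g S"
  using assms(2,3)
proof (induction k arbitrary: f g)
  case 0
  then show ?case by (simp cong: continuous_on_cong)
next
  case (Suc k)
  have "deriv f x = deriv g x" if "x \<in> S" for x
    using eventually_nhds_in_open[OF assms(1) that] Suc.prems(2)
    by (intro deriv_cong_ev refl) (auto elim: eventually_mono)
  moreover have "g differentiable_on S"
    unfolding differentiable_on_def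
  proof
    fix x assume x: "x \<in> S"
    then have "f differentiable (at x within S)"
      using Suc.prems(1) by (simp add: differentiable_on_def)
    from this zero_less_one x show "g differentiable (at x within S)"
      by (rule differentiable_transform_within) (rule Suc.prems(2))
  qed
  ultimately show ?case
    using Suc.IH[of "deriv f" "deriv g"] Suc.prems by simp
qed

lemma Ck_on_imp_continuous_on: "Ck_on k f S \<Longrightarrow> continuous_on S f"
  by (cases k) (auto intro: differentiable_imp_continuous_on)

lemma differentiable_on_open_DERIV:
  fixes f :: "real \<Rightarrow> real"
  assumes "f differentiable_on S" "open S" "x \<in> S"
  shows "(f has_real_derivative deriv f x) (at x)"
  using assms differentiable_on_eq_differentiable_at[of S f] DERIV_deriv_iff_real_differentiable by auto

lemma Ck_on_uminus:
  assumes "open S" "Ck_on k f S"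
  shows "Ck_on k (\<lambda>x. - f x) S"
  using assms(2)
proof (induction k arbitrary: f)
  case 0
  then show ?case by (simp add: continuous_on_minus)
next
  case (Suc k)
  have neg: "- deriv f x = deriv (\<lambda>x. - f x) x" if "x \<in> S" for x
    using differentiable_on_open_DERIV[of f S x] Suc.prems assms(1) that
    by (intro DERIV_imp_deriv[symmetric] DERIV_minus) simp
  have "Ck_on k (\<lambda>x. - deriv f x) S"
    using Suc by simp
  from Ck_on_cong[OF assms(1) this neg] have "Ck_on k (deriv (\<lambda>x. - f x)) S" .
  then show ?case
    using Suc.prems by (simp add: differentiable_on_minus)
qed

lemma smooth_kernel_if_Ck_on:
  assumes pd: "positive_definite \<Phi>" and U: "open U" "0 \<in> U" and Ck: "Ck_on (2 * Suc n) \<Phi> U"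
  obtains r where "smooth_kernel \<Phi> (deriv \<Phi>) (deriv (deriv \<Phi>)) r"
proof -
  obtain r where r: "r > 0" "ball 0 r \<subseteq> U"
    using U openE by blast
  have inU: "x \<in> U" if "\<bar>x\<bar> < r" for x
    using r(2) that by auto
  have "\<Phi> differentiable_on U" "deriv \<Phi> differentiable_on U" "continuous_on U (deriv (deriv \<Phi>))"
    using Ck by (auto intro: Ck_on_imp_continuous_on)
  then have "smooth_kernel \<Phi> (deriv \<Phi>) (deriv (deriv \<Phi>)) r"
    using pd r(1) U inU differentiable_on_open_DERIV continuous_on_eq_continuous_at
    by unfold_locales blast+
  with that show ?thesis .
qed

text \<open>Each step gains two derivatives on the whole line and passes to
  \<open>- deriv (deriv \<Phi>)\<close>, which is again positive definite and smooth on the same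
  \<open>U\<close>.\<close>

lemma positive_definite_Ck_on_UNIV:
  assumes "positive_definite \<Phi>" "open U" "0 \<in> U" "Ck_on (2 * n) \<Phi> U"
  shows "Ck_on (2 * n) \<Phi> UNIV"
  using assms(1,4)
proof (induction n arbitrary: \<Phi>)
  case 0
  then have "isCont \<Phi> 0"
    using assms(2,3) continuous_on_eq_continuous_at by auto
  then show ?case
    using positive_definite_isCont[OF 0(1)] by (simp add: continuous_at_imp_continuous_on)
next
  case (Suc n)
  obtain r where "smooth_kernel \<Phi> (deriv \<Phi>) (deriv (deriv \<Phi>)) r"
    using smooth_kernel_if_Ck_on[OF Suc.prems(1) assms(2,3) Suc.prems(2)] .
  then interpret smooth_kernel \<Phi> "deriv \<Phi>" "deriv (deriv \<Phi>)" r .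
  have "Ck_on (2 * n) (\<lambda>x. - deriv (deriv \<Phi>) x) U"
    using Suc.prems(2) by (intro Ck_on_uminus assms(2)) simp
  from Ck_on_uminus[OF open_UNIV Suc.IH[OF positive_definite_minus_deriv2 this]]
  have "Ck_on (2 * n) (deriv (deriv \<Phi>)) UNIV" by simp
  moreover have "\<Phi> differentiable_on UNIV" "deriv \<Phi> differentiable_on UNIV"
    using DERIV_kernel DERIV_deriv_kernel
    by (auto simp: differentiable_on_def real_differentiable_def)
  ultimately show ?case by simp
qed

subsection \<open>Tempered stable measures\<close>

text \<open>One half-line only: the negative half of \<open>gts_density\<close> is a reflection, so
  one estimate serves both.\<close>

definition tempered_density :: "(real \<Rightarrow> real) \<Rightarrow> real \<Rightarrow> real \<Rightarrow> real \<Rightarrow> real \<Rightarrow> real" where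
  "tempered_density w \<alpha> C \<beta> z = indicator {0<..} z *\<^sub>R (C * w (\<beta> * z) / z powr (1 + \<alpha>))"

lemma gts_density_eq:
  "gts_density w \<alpha>p \<alpha>m Cp Cm \<beta>p \<beta>m z
    = tempered_density w \<alpha>p Cp \<beta>p z + tempered_density w \<alpha>m Cm \<beta>m (- z)"
  by (cases z "0::real" rule: linorder_cases) (simp_all add: gts_density_def tempered_density_def)

text \<open>By monotonicity \<open>w z\<close> lies below the values at smaller arguments, which
  tend to \<open>1\<close>.\<close>

lemma class_W_bounds:
  assumes "w \<in> class_W" "z > 0"
  shows "0 \<le> w z" "w z \<le> 1"
proof -
  show "0 \<le> w z" using assms by (simp add: class_W_def)
  have "antimono_on {0<..} w" and lim: "(w \<longlongrightarrow> 1) (at_right 0)"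
    using assms by (simp_all add: class_W_def)
  then have "w z \<le> w y" if "0 < y" "y < z" for y
    using that assms(2) by (auto dest!: monotone_onD[where x=y and y=z])
  then have "eventually (\<lambda>y. w z \<le> w y) (at_right 0)"
    using assms(2) by (auto simp: eventually_at_right_field)
  then show "w z \<le> 1"
    by (intro tendsto_lowerbound[OF lim]) auto
qed

lemma tempered_density_nonneg:
  assumes "w \<in> class_W" "C > 0" "\<beta> > 0"
  shows "0 \<le> tempered_density w \<alpha> C \<beta> z"
  using assms class_W_bounds(1)[OF assms(1), of "\<beta> * z"]
  by (auto simp: tempered_density_def indicator_def)

lemma borel_measurable_tempered_density [measurable]:
  assumes "w \<in> class_W" "\<beta> > 0"
  shows "tempered_density w \<alpha> C \<beta> \<in> borel_measurable borel"
proof -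
  have "continuous_on {0<..} w" using assms by (simp add: class_W_def)
  then have "continuous_on {0<..} (\<lambda>z. w (\<beta> * z))"
    by (rule continuous_on_compose2) (use assms(2) in \<open>auto intro: continuous_on_mult_left\<close>)
  then have "continuous_on {0<..} (\<lambda>z. C * w (\<beta> * z) / z powr (1 + \<alpha>))"
    by (intro continuous_intros) auto
  then show ?thesis
    unfolding tempered_density_def[abs_def] by (intro borel_measurable_continuous_on_indicator) auto
qed

text \<open>For nonnegative functions gauge integrability is absolute, and Borel measurability
  brings it from the completed measure to \<open>lborel\<close>.\<close>

lemma integrable_lborel_powr:
  assumes "(\<lambda>z::real. z powr a) integrable_on A" "A \<in> sets borel"
  shows "integrable lborel (\<lambda>z. indicator A z * z powr a)"
proof -
  have [measurable]: "A \<in> sets borel" by fact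
  have "(\<lambda>z. z powr a) absolutely_integrable_on A"
    using assms(1) by (rule nonnegative_absolutely_integrable_1) simp
  moreover have "(\<lambda>z. indicator A z * z powr a) \<in> borel_measurable lborel"
    by measurable
  ultimately show ?thesis
    by (simp add: set_integrable_def integrable_completion)
qed

lemma integrable_tempered_density:
  assumes w: "w \<in> class_W" and par: "\<alpha> < 2" "C > 0" "\<beta> > 0"
    and bdd: "\<And>m::nat. bounded (range (\<lambda>z::real. \<bar>z\<bar> ^ m * (C * w (\<beta> * \<bar>z\<bar>))))"
  shows "integrable lborel (\<lambda>z. tempered_density w \<alpha> C \<beta> z * min 1 (z\<^sup>2))"
proof -
  \<comment> \<open>\<open>z\<^sup>m w(\<beta> z)\<close> bounded makes the tail \<open>O(z powr (-m - 1 - \<alpha>))\<close>, which is \<open>O(z powr -2)\<close>.\<close>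
  define m where "m = nat \<lceil>1 - \<alpha>\<rceil>"
  have m: "real m \<ge> 1 - \<alpha>" unfolding m_def by linarith
  obtain B where B: "\<And>z::real. \<bar>\<bar>z\<bar> ^ m * (C * w (\<beta> * \<bar>z\<bar>))\<bar> \<le> B"
    using bdd[of m] by (force simp: bounded_iff)
  have B0: "B \<ge> 0" using B[of 0] by linarith
  \<comment> \<open>Near the origin \<open>w \<le> 1\<close> and the factor \<open>z\<^sup>2\<close>
    leave the exponent \<open>1 - \<alpha>\<close>, which exceeds \<open>- 1\<close> because
    \<open>\<alpha> < 2\<close>.\<close>
  let ?g = "\<lambda>z. C * (indicator {0..1} z * z powr (1 - \<alpha>)) + B * (indicator {1..} z * z powr - 2)"
  show ?thesis
  proof (rule Bochner_Integration.integrable_bound[of _ ?g])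
    show "integrable lborel ?g"
      using par has_integral_powr_to_inf[of "- 2" 1]
      by (intro Bochner_Integration.integrable_add integrable_mult_right integrable_lborel_powr
          integrable_on_powr_from_0) (auto simp: integrable_on_def)
    show "(\<lambda>z. tempered_density w \<alpha> C \<beta> z * min 1 (z\<^sup>2)) \<in> borel_measurable lborel"
      using borel_measurable_tempered_density[OF w par(3)] by simp
    have "tempered_density w \<alpha> C \<beta> z * min 1 (z\<^sup>2) \<le> ?g z" for z
    proof -
      consider "z \<le> 0" | "0 < z" "z \<le> 1" | "z > 1" by linarith
      then show ?thesis
      proof cases
        case 1
        then show ?thesis using par(2) B0 by (simp add: tempered_density_def)
      next
        case 2
        have "min 1 (z\<^sup>2) = z powr 2"
          using 2 by (simp add: min_absorb2 power_le_one_iff)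
        then have "tempered_density w \<alpha> C \<beta> z * min 1 (z\<^sup>2)
            = w (\<beta> * z) * (C * (z powr 2 / z powr (1 + \<alpha>)))"
          using 2 by (simp add: tempered_density_def)
        also have "z powr 2 / z powr (1 + \<alpha>) = z powr (1 - \<alpha>)"
          by (simp only: powr_diff[symmetric]) simp
        also have "w (\<beta> * z) * (C * z powr (1 - \<alpha>)) \<le> C * z powr (1 - \<alpha>)"
          using class_W_bounds[OF w, of "\<beta> * z"] 2 par by (intro mult_left_le_one_le) auto
        also have "\<dots> \<le> ?g z"
          using 2 B0 by simp
        finally show ?thesis .
      next
        case 3
        \<comment> \<open>The exponent \<open>- (1 + \<alpha>)\<close> is split into
          \<open>1 - \<alpha>\<close> and \<open>- 2\<close>; the first part is absorbed by
          \<open>m\<close>.\<close>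
        have "z powr real m * (C * w (\<beta> * z)) \<le> B"
          using B[of z] 3 by (simp add: powr_realpow abs_le_iff)
        moreover have "z powr (1 - \<alpha>) * (C * w (\<beta> * z)) \<le> z powr real m * (C * w (\<beta> * z))"
          using class_W_bounds[OF w, of "\<beta> * z"] 3 par m by (intro mult_right_mono powr_mono) auto
        ultimately have "C * w (\<beta> * z) * z powr (1 - \<alpha>) \<le> B"
          by (simp add: mult.commute)
        then have "C * w (\<beta> * z) * z powr (1 - \<alpha>) * z powr - 2 \<le> B * z powr - 2"
          by (intro mult_right_mono) auto
        moreover have "z powr (1 - \<alpha>) * z powr - 2 = 1 / z powr (1 + \<alpha>)"
          by (simp only: powr_minus_divide[symmetric] powr_add[symmetric]) simp
        moreover have "min 1 (z\<^sup>2) = 1"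
          using 3 by (simp add: min_absorb1 one_le_power)
        ultimately show ?thesis
          using 3 by (simp add: tempered_density_def mult.assoc)
      qed
    qed
    then show "AE z in lborel. norm (tempered_density w \<alpha> C \<beta> z * min 1 (z\<^sup>2)) \<le> norm (?g z)"
      using tempered_density_nonneg[OF w par(2,3)]
      by (intro always_eventually allI) (force simp: abs_mult intro: order_trans[OF _ abs_ge_self])
  qed
qed

text \<open>The Levy measure condition, through which alone \<nu> enters the estimates of the jump
  integral.\<close>

lemma gen_tempered_stable_levy:
  assumes "gen_tempered_stable \<nu>"
  shows "sets \<nu> = sets borel" "integrable \<nu> (\<lambda>z. min 1 (z\<^sup>2))"
proof -
  obtain w \<alpha>p \<alpha>m Cp Cm \<beta>p \<beta>m where w: "w \<in> class_W"
    and p: "\<alpha>p < 2" "Cp > 0" "\<beta>p > 0"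
      "\<And>m::nat. bounded (range (\<lambda>z::real. \<bar>z\<bar> ^ m * (Cp * w (\<beta>p * \<bar>z\<bar>))))"
    and n: "\<alpha>m < 2" "Cm > 0" "\<beta>m > 0"
      "\<And>m::nat. bounded (range (\<lambda>z::real. \<bar>z\<bar> ^ m * (Cm * w (\<beta>m * \<bar>z\<bar>))))"
    and \<nu>: "\<nu> = density lborel (\<lambda>z. ennreal (gts_density w \<alpha>p \<alpha>m Cp Cm \<beta>p \<beta>m z))"
    using assms unfolding gen_tempered_stable_def by blast
  let ?p = "tempered_density w \<alpha>p Cp \<beta>p" and ?n = "tempered_density w \<alpha>m Cm \<beta>m"
  show "sets \<nu> = sets borel" by (simp add: \<nu>)
  have [measurable]: "?p \<in> borel_measurable borel" "?n \<in> borel_measurable borel"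
    using w p n by auto
  \<comment> \<open>The reflection is written as an affine substitution with slope
    \<open>- 1\<close>.\<close>
  have "integrable lborel (\<lambda>z. ?n (0 + - 1 * z) * min 1 ((0 + - 1 * z)\<^sup>2))"
    by (rule lborel_integrable_real_affine[OF integrable_tempered_density[OF w n]]) simp
  then have "integrable lborel (\<lambda>z. ?n (- z) * min 1 (z\<^sup>2))" by simp
  with integrable_tempered_density[OF w p]
  have "integrable lborel (\<lambda>z. ?p z * min 1 (z\<^sup>2) + ?n (- z) * min 1 (z\<^sup>2))"
    by (rule Bochner_Integration.integrable_add)
  moreover have "AE z in lborel. 0 \<le> ?p z + ?n (- z)"
    using w p n by (simp add: tempered_density_nonneg)
  ultimately show "integrable \<nu> (\<lambda>z. min 1 (z\<^sup>2))"
    unfolding \<nu> gts_density_eq by (subst integrable_density) (simp_all add: distrib_right)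
qed

text \<open>Absence of a singularity at the origin is expressed as continuity of the jump integral
  at \<open>0\<close>.\<close>

theorem theorem4p6:
  fixes \<Phi> :: "real \<Rightarrow> real" and n :: nat
  assumes "strictly_positive_definite \<Phi>"
    and "n \<ge> 2"
    and "\<exists>U. open U \<and> 0 \<in> U \<and> Ck_on (2 * n) \<Phi> U"
  shows "Ck_on (2 * n) \<Phi> UNIV \<and>
    (\<forall>\<nu>. gen_tempered_stable \<nu> \<longrightarrow>
       (\<forall>x. integrable \<nu> (jump_integrand \<Phi> x)) \<and> isCont (jump_integral \<Phi> \<nu>) 0)"
proof -
  have pd: "positive_definite \<Phi>"
    using assms(1) by (simp add: strictly_positive_definite_def)
  obtain U where U: "open U" "0 \<in> U" "Ck_on (2 * n) \<Phi> U"
    using assms(3) by blast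
  obtain m where "n = Suc m"
    using assms(2) by (cases n) auto
  then obtain r where "smooth_kernel \<Phi> (deriv \<Phi>) (deriv (deriv \<Phi>)) r"
    using smooth_kernel_if_Ck_on[OF pd U(1,2), of m] U(3) by blast
  then interpret smooth_kernel \<Phi> "deriv \<Phi>" "deriv (deriv \<Phi>)" r .
  show ?thesis
    using positive_definite_Ck_on_UNIV[OF pd U] integrable_jump_integrand isCont_jump_integral
      gen_tempered_stable_levy by blast
qed

end
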